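(* For all integers $l\ge1$ and $n\ge2$, $$\beth(3,l,n)\le (2l-1)(n-1)(n-2).$$
   Context: Fix a totally ordered alphabet $a_1<\dots<a_l$. A word is primitive if it is not of the form $v^k$ with $k>1$. A system of type $X(t,l)$ is a finite sequence $(w_1,\dots,w_N)$ of primitive words of length $t$ over this alphabet, no two of which are cyclic shifts of each other. For $1\le i\le N$, $1\le j\le t$, let $w(i,j)$ be the cyclic shift of $w_i$ beginning with its $j$-th letter. Define a strict partial order on the pairs $(i,j)$ by $(i_1,j_1)\prec(i_2,j_2)$ iff $i_1<i_2$ and $w(i_1,j_1)$ is lexicographically smaller than $w(i_2,j_2)$. The system is $n$-light if there are no $n$ pairwise $\prec$-incomparable pairs. $\beth(t,l,n)$ denotes the largest $N$ of an $n$-light system of type $X(t,l)$. *)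

theory Defs
  imports Main "HOL-Library.Extended_Nat"
begin

text \<open>The alphabet a_1 < ... < a_l is modelled as the naturals 0 < 1 < ... < l-1.
  Words are lists. Indices i (words) and j (shift positions) are 0-based.\<close>

definition primitive :: "nat list \<Rightarrow> bool" where
  "primitive w \<longleftrightarrow> \<not> (\<exists>v k. k > 1 \<and> w = concat (replicate k v))"

definition lex_less :: "nat list \<Rightarrow> nat list \<Rightarrow> bool" where
  "lex_less u v \<longleftrightarrow> (u, v) \<in> lexord {(a, b). a < b}"

definition wshift :: "nat list list \<Rightarrow> nat \<Rightarrow> nat \<Rightarrow> nat list" where
  "wshift ws i j = rotate j (ws ! i)"

definition is_system :: "nat \<Rightarrow> nat \<Rightarrow> nat list list \<Rightarrow> bool" where
  "is_system t l ws \<longleftrightarrow>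
     (\<forall>i < length ws. length (ws ! i) = t \<and> set (ws ! i) \<subseteq> {0..<l} \<and> primitive (ws ! i)) \<and>
     (\<forall>i < length ws. \<forall>i' < length ws. i \<noteq> i' \<longrightarrow> (\<forall>k. rotate k (ws ! i) \<noteq> ws ! i'))"

definition prec :: "nat list list \<Rightarrow> nat \<times> nat \<Rightarrow> nat \<times> nat \<Rightarrow> bool" where
  "prec ws p q \<longleftrightarrow> fst p < fst q \<and> lex_less (wshift ws (fst p) (snd p)) (wshift ws (fst q) (snd q))"

definition n_light :: "nat \<Rightarrow> nat \<Rightarrow> nat list list \<Rightarrow> bool" where
  "n_light t n ws \<longleftrightarrow>
     \<not> (\<exists>S. S \<subseteq> {0..<length ws} \<times> {0..<t} \<and> card S = n \<and>
           (\<forall>p\<in>S. \<forall>q\<in>S. p \<noteq> q \<longrightarrow> \<not> prec ws p q \<and> \<not> prec ws q p))"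

text \<open>beth(t,l,n), as an extended natural (the supremum, which is the maximum when finite).\<close>
definition beth :: "nat \<Rightarrow> nat \<Rightarrow> nat \<Rightarrow> enat" where
  "beth t l n = Sup {enat (length ws) | ws. is_system t l ws \<and> n_light t n ws}"

end

theory Submission
  imports Defs
begin

text \<open>Put a shift below another if its word index is at most the other's and it is
  lexicographically larger. As all shifts are distinct, this is a strict partial order whose
  comparable pairs are exactly the incomparable pairs of \<^const>\<open>prec\<close>. Hence Dilworth's
  decomposition into \<open>n - 1\<close> chains (the colours) is obtained from Mirsky's easy argument,
  applied to this conjugate order. The three shifts of one word
  \<open>xyz\<close> get distinct colours \<open>p, q, r\<close>; record the word as the three edges
  \<open>(p,x) \<rightarrow> (q,y)\<close>, \<open>(q,y) \<rightarrow> (r,z)\<close>, \<open>(r,z) \<rightarrow> (p,x)\<close>.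

  Within a colour first letters increase weakly, so the edges between two given colours form a
  monotone staircase in an \<open>l \<times> l\<close> grid, and there are at most \<open>2 l - 1\<close> of them. Moreover every
  word has an edge that occurs in no earlier word. Otherwise \<open>xyz\<close> is preceded by words \<open>xyz'\<close>,
  \<open>yzx'\<close> and \<open>zxy'\<close> (up to shift) with \<open>z' < z\<close>, \<open>x' < x\<close>, \<open>y' < y\<close>; comparing \<open>yz'x < yzx'\<close>
  within colour \<open>q\<close> puts the first before the second, and cyclically the second before the third
  before the first.\<close>

text \<open>The colour of \<open>x\<close> is the largest size of a chain lying strictly below
  \<open>x\<close>. Adding \<open>x\<close> on top lengthens that chain by one, which bounds the
  colour and makes it increase along \<open>R\<close>.\<close>

lemma mirsky_colouring:
  fixes R :: "'a \<Rightarrow> 'a \<Rightarrow> bool"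
  assumes "finite V"
    and trans: "\<And>x y z. R x y \<Longrightarrow> R y z \<Longrightarrow> R x z"
    and irrefl: "\<And>x. \<not> R x x"
    and no_chain: "\<And>A. A \<subseteq> V \<Longrightarrow> (\<And>x y. x \<in> A \<Longrightarrow> y \<in> A \<Longrightarrow> x \<noteq> y \<Longrightarrow> R x y \<or> R y x) \<Longrightarrow> card A \<noteq> n"
  obtains c :: "'a \<Rightarrow> nat" where "\<And>x. x \<in> V \<Longrightarrow> c x < n - 1"
    and "\<And>x y. x \<in> V \<Longrightarrow> y \<in> V \<Longrightarrow> R x y \<Longrightarrow> c x < c y"
proof -
  define chain where "chain A \<longleftrightarrow> A \<subseteq> V \<and> (\<forall>x\<in>A. \<forall>y\<in>A. x \<noteq> y \<longrightarrow> R x y \<or> R y x)" for A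
  define below where "below x = {A. chain A \<and> (\<forall>a\<in>A. R a x)}" for x
  define c where "c x = Max (card ` below x)" for x
  have fin: "finite (below x)" for x
    by (rule finite_subset[of _ "Pow V"]) (auto simp: below_def chain_def \<open>finite V\<close>)
  have attained: "\<exists>A. chain A \<and> card A = Suc (c x) \<and> (\<forall>a\<in>A. a = x \<or> R a x)" if "x \<in> V" for x
  proof -
    have "{} \<in> below x" by (simp add: below_def chain_def)
    hence "c x \<in> card ` below x" unfolding c_def using fin by (intro Max_in) auto
    then obtain A where A: "A \<in> below x" "card A = c x" by auto
    have "x \<notin> A" using A irrefl by (auto simp: below_def)
    moreover have "finite A"
      using A \<open>finite V\<close> by (auto simp: below_def chain_def intro: finite_subset)
    moreover have "chain (insert x A)"
      using A \<open>x \<in> V\<close> by (auto simp: below_def chain_def)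
    ultimately show ?thesis using A by (intro exI[of _ "insert x A"]) (auto simp: below_def)
  qed
  \<comment> \<open>Subsets of chains are chains, so a longer chain would contain one of size
    exactly \<open>n\<close>.\<close>
  have small: "card A < n" if "chain A" for A
  proof (rule ccontr)
    assume "\<not> card A < n"
    then obtain B where B: "B \<subseteq> A" "card B = n"
      by (meson not_less obtain_subset_with_card_n)
    have "card B \<noteq> n"
      using that B by (intro no_chain) (auto simp: chain_def)
    with B show False by simp
  qed
  show thesis
  proof
    fix x assume "x \<in> V"
    with attained small show "c x < n - 1" by fastforce
  next
    fix x y assume "x \<in> V" "y \<in> V" "R x y"
    obtain A where A: "chain A" "card A = Suc (c x)" "\<forall>a\<in>A. a = x \<or> R a x"
      using attained[OF \<open>x \<in> V\<close>] by auto
    hence "A \<in> below y" using \<open>R x y\<close> trans by (auto simp: below_def)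
    hence "card A \<le> c y" unfolding c_def using fin by (intro Max_ge) auto
    with A show "c x < c y" by simp
  qed
qed

lemma lex_less_trans: "lex_less u v \<Longrightarrow> lex_less v w \<Longrightarrow> lex_less u w"
  unfolding lex_less_def by (rule lexord_trans) (auto intro: transI)

lemma lex_less_irrefl: "\<not> lex_less u u"
  unfolding lex_less_def by (intro lexord_irreflexive) auto

lemma lex_less_asym: "lex_less u v \<Longrightarrow> \<not> lex_less v u"
  by (meson lex_less_irrefl lex_less_trans)

lemma lex_less_linear: "u \<noteq> v \<Longrightarrow> lex_less u v \<or> lex_less v u"
  unfolding lex_less_def using lexord_linear[of "{(a, b). a < b}" u v] linorder_less_linear
  by blast

lemma lex_less_triple:
  "lex_less [x, y, z] [x', y', z'] \<longleftrightarrow> x < x' \<or> x = x' \<and> (y < y' \<or> y = y' \<and> z < z')"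
  by (auto simp: lex_less_def)

lemma card_off_diagonal: "card (SIGMA p:{..<m::nat}. {..<m} - {p}) = m * (m - 1)"
  by simp

text \<open>Each word is charged to one fresh edge. Positions run over all naturals with period 3,
  so that the cyclic successor is simply \<open>j + 1\<close>.\<close>

lemma coloured_triples_bound:
  fixes a C :: "nat \<Rightarrow> nat \<Rightarrow> nat"
  assumes periodic: "\<And>i j. a i (j + 3) = a i j" "\<And>i j. C i (j + 3) = C i j"
    and letters: "\<And>i j. i < N \<Longrightarrow> a i j < l"
    and colours: "\<And>i j. i < N \<Longrightarrow> C i j < m"
    and colour_neq: "\<And>i j. i < N \<Longrightarrow> C i j \<noteq> C i (j + 1)"
    and monotone: "\<And>i i' j j'. i < N \<Longrightarrow> i' < N \<Longrightarrow> C i j = C i' j' \<Longrightarrow>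
      i < i' \<longleftrightarrow> lex_less [a i j, a i (j + 1), a i (j + 2)] [a i' j', a i' (j' + 1), a i' (j' + 2)]"
  shows "N \<le> (2 * l - 1) * m * (m - 1)"
proof -
  define edge where "edge i j = (C i j, a i j, C i (j + 1), a i (j + 1))" for i j
  note three = periodic[simplified numeral_3_eq_3, simplified]
  have fresh: "\<exists>j. \<forall>i' < i. \<forall>j'. edge i' j' \<noteq> edge i j" if "i < N" for i
  proof (rule ccontr)
    assume "\<not> ?thesis"
    hence old: "\<exists>i' < i. \<exists>j'. edge i' j' = edge i j" for j by blast
    \<comment> \<open>The earlier word carrying edge \<open>j\<close> has a smaller third letter.\<close>
    have "\<exists>k < i. \<exists>j'. edge k j' = edge i j \<and> a k (j' + 2) < a i (j + 2)" for j
    proof -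
      obtain k j' where k: "k < i" "edge k j' = edge i j" using old by blast
      with \<open>i < N\<close> monotone[of k i j' j] show ?thesis
        by (auto simp: edge_def lex_less_triple)
    qed
    then obtain K J where KJ: "\<And>j. K j < i" "\<And>j. edge (K j) (J j) = edge i j"
        "\<And>j. a (K j) (J j + 2) < a i (j + 2)"
      by metis
    \<comment> \<open>Both words are read from the shared node with colour
      \<open>C i (j + 1)\<close> and letter \<open>a i (j + 1)\<close>; the next letter is smaller
      in word \<open>K j\<close>.\<close>
    have "K j < K (j + 1)" for j
      using KJ[of j] KJ[of "j + 1"] \<open>i < N\<close> monotone[of "K j" "K (j + 1)" "J j + 1" "J (j + 1)"]
      by (auto simp: edge_def lex_less_triple three)
    \<comment> \<open>\<open>K\<close> is an arbitrary choice and need not have period 3, so the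
      contradiction comes from unbounded growth below \<open>i\<close> instead of a closed
      cycle.\<close>
    hence "strict_mono K" by (simp add: strict_mono_Suc_iff)
    hence "i \<le> K i" by (rule strict_mono_imp_increasing)
    with KJ(1)[of i] show False by simp
  qed
  then obtain f where f: "\<And>i i' j'. i < N \<Longrightarrow> i' < i \<Longrightarrow> edge i' j' \<noteq> edge i (f i)"
    by metis
  \<comment> \<open>On a staircase both letters grow weakly, so their sum determines the pair; it
    takes values from 0 to \<open>2 * l - 2\<close>.\<close>
  define g where "g i = ((C i (f i), C i (f i + 1)), a i (f i) + a i (f i + 1))" for i
  have g_less: "g i \<noteq> g i'" if "i < i'" "i' < N" for i i'
  proof
    assume eq: "g i = g i'"
    from that eq have "a i (f i) \<le> a i' (f i')" "a i (f i + 1) \<le> a i' (f i' + 1)"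
      using monotone[of i i' "f i" "f i'"] monotone[of i i' "f i + 1" "f i' + 1"]
      by (auto simp: g_def lex_less_triple)
    with eq have "edge i (f i) = edge i' (f i')"
      by (auto simp: g_def edge_def)
    with f that show False by blast
  qed
  let ?T = "(SIGMA p:{..<m}. {..<m} - {p}) \<times> {..<2 * l - 1}"
  have "inj_on g {..<N}"
    by (rule inj_onI) (metis g_less lessThan_iff linorder_neqE_nat)
  moreover have "g ` {..<N} \<subseteq> ?T"
  proof (rule image_subsetI)
    fix i assume "i \<in> {..<N}"
    hence "i < N" by simp
    hence "a i (f i) + a i (f i + 1) < 2 * l - 1"
      using letters[of i "f i"] letters[of i "f i + 1"] by linarith
    with \<open>i < N\<close> colours colour_neq[of i "f i"] show "g i \<in> ?T" by (simp add: g_def)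
  qed
  moreover have "finite ?T" by blast
  ultimately have "card {..<N} \<le> card ?T" by (rule card_inj_on_le)
  thus ?thesis by (simp only: card_cartesian_product card_off_diagonal card_lessThan mult_ac)
qed

lemma rotate_triple:
  assumes "length w = 3"
  shows "rotate j w = [w ! (j mod 3), w ! ((j + 1) mod 3), w ! ((j + 2) mod 3)]"
proof (rule nth_equalityI)
  fix i assume "i < length (rotate j w)"
  with assms have "i = 0 \<or> i = 1 \<or> i = 2" by auto
  with assms show "rotate j w ! i = [w ! (j mod 3), w ! ((j + 1) mod 3), w ! ((j + 2) mod 3)] ! i"
    by (auto simp: nth_rotate)
qed (simp add: assms)

lemma primitive_not_constant: "\<not> primitive [x, x, x]"
  unfolding primitive_def not_not
  by (intro exI[of _ "[x]"] exI[of _ "3::nat"]) (simp add: numeral_3_eq_3)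

text \<open>As 3 is prime, a triple fixed by a nontrivial rotation is constant.\<close>

lemma primitive_triple_rotations:
  assumes "length w = 3" "primitive w" "j < 3" "j' < 3" "rotate j w = rotate j' w"
  shows "j = j'"
proof -
  obtain x y z where w: "w = [x, y, z]"
    using assms(1) by (auto simp: length_Suc_conv numeral_3_eq_3)
  have "\<not> (x = y \<and> y = z)" using assms(2) primitive_not_constant w by auto
  moreover have "j = 0 \<or> j = 1 \<or> j = 2" "j' = 0 \<or> j' = 1 \<or> j' = 2"
    using assms(3,4) by auto
  ultimately show ?thesis
    using assms(5) w by (auto simp: rotate_triple)
qed

lemma system_shift_inj:
  assumes sys: "is_system 3 l ws" and "i < length ws" "i' < length ws" "j < 3" "j' < 3"
    and eq: "wshift ws i j = wshift ws i' j'"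
  shows "i = i' \<and> j = j'"
proof -
  have len: "length (ws ! i) = 3" "length (ws ! i') = 3"
    using assms by (auto simp: is_system_def)
  \<comment> \<open>Rotating on by \<open>3 - j'\<close> completes a full turn, which exhibits
    \<open>ws ! i'\<close> as a rotation of \<open>ws ! i\<close>.\<close>
  have "rotate (3 - j' + j) (ws ! i) = rotate (3 - j') (rotate j' (ws ! i'))"
    using eq by (simp add: wshift_def flip: rotate_rotate)
  also have "\<dots> = ws ! i'"
    using \<open>j' < 3\<close> len by (simp add: rotate_rotate)
  finally have "i = i'" using assms unfolding is_system_def by blast
  with assms len primitive_triple_rotations[of "ws ! i" j j'] show ?thesis
    by (auto simp: is_system_def wshift_def)
qed

lemma light_system_bound:
  assumes sys: "is_system 3 l ws" and light: "n_light 3 n ws"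
  shows "length ws \<le> (2 * l - 1) * (n - 1) * (n - 2)"
proof -
  define N where "N = length ws"
  define V where "V = {0..<N} \<times> {0..<3::nat}"
  define word where "word e = wshift ws (fst e) (snd e)" for e
  define R where "R e f \<longleftrightarrow> fst e \<le> fst f \<and> lex_less (word f) (word e)" for e f
  have not_prec: "\<not> prec ws e f \<and> \<not> prec ws f e" if "R e f" for e f
    using that lex_less_asym[of "word f" "word e"] by (auto simp: R_def prec_def word_def)
  obtain c where c: "\<And>e. e \<in> V \<Longrightarrow> c e < n - 1"
      and cR: "\<And>e f. e \<in> V \<Longrightarrow> f \<in> V \<Longrightarrow> R e f \<Longrightarrow> c e < (c f :: nat)"
  proof (rule mirsky_colouring[of V R n])
    show "finite V" by (simp add: V_def)
    show "R x z" if "R x y" "R y z" for x y z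
      using that lex_less_trans[of "word z" "word y" "word x"] by (auto simp: R_def)
    show "\<not> R x x" for x by (simp add: R_def lex_less_irrefl)
    show "card A \<noteq> n"
      if "A \<subseteq> V" "\<And>x y. x \<in> A \<Longrightarrow> y \<in> A \<Longrightarrow> x \<noteq> y \<Longrightarrow> R x y \<or> R y x" for A
    proof -
      have "\<forall>p\<in>A. \<forall>q\<in>A. p \<noteq> q \<longrightarrow> \<not> prec ws p q \<and> \<not> prec ws q p"
        using that(2) not_prec by metis
      with light that(1) show ?thesis unfolding n_light_def V_def N_def by metis
    qed
  qed blast
  have word_neq: "lex_less (word e) (word f) \<or> lex_less (word f) (word e)"
    if "e \<in> V" "f \<in> V" "e \<noteq> f" for e f
    using that system_shift_inj[OF sys, of "fst e" "fst f" "snd e" "snd f"]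
    by (intro lex_less_linear) (auto simp: V_def N_def word_def)
  have cmp: "lex_less (word e) (word f)"
    if "e \<in> V" "f \<in> V" "c e = c f" "fst e < fst f" for e f
    using that word_neq[of e f] cR[of e f] by (auto simp: R_def)
  \<comment> \<open>The weak inequality in \<open>R\<close> makes any two shifts of one word
    comparable, hence differently coloured.\<close>
  have same_index: "e = f" if "e \<in> V" "f \<in> V" "c e = c f" "fst e = fst f" for e f
    using that word_neq[of e f] cR[of e f] cR[of f e] by (auto simp: R_def)
  have iff: "fst e < fst f \<longleftrightarrow> lex_less (word e) (word f)"
    if "e \<in> V" "f \<in> V" "c e = c f" for e f
    using that cmp[of e f] cmp[of f e] same_index[of e f] lex_less_irrefl[of "word e"]
      lex_less_asym[of "word e" "word f"] by (metis linorder_neqE_nat)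
  define a where "a i j = ws ! i ! (j mod 3)" for i j
  define C where "C i j = c (i, j mod 3)" for i j
  have word: "word (i, j mod 3) = [a i j, a i (j + 1), a i (j + 2)]" if "i < N" for i j
  proof -
    have "length (ws ! i) = 3" using sys that by (simp add: is_system_def N_def)
    thus ?thesis by (simp add: rotate_triple word_def wshift_def a_def mod_simps)
  qed
  have "N \<le> (2 * l - 1) * (n - 1) * (n - 1 - 1)"
  proof (rule coloured_triples_bound[of a C])
    fix i i' j j' assume *: "i < N" "i' < N" "C i j = C i' j'"
    then show "i < i' \<longleftrightarrow> lex_less [a i j, a i (j + 1), a i (j + 2)]
        [a i' j', a i' (j' + 1), a i' (j' + 2)]"
      using iff[of "(i, j mod 3)" "(i', j' mod 3)"] by (auto simp: V_def C_def word)
  next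
    fix i j assume "i < N"
    then have "length (ws ! i) = 3" "set (ws ! i) \<subseteq> {0..<l}"
      using sys by (auto simp: is_system_def N_def)
    then show "a i j < l"
      unfolding a_def by (metis atLeastLessThan_iff mod_less_divisor nth_mem subsetD zero_less_numeral)
    show "C i j < n - 1" using \<open>i < N\<close> c by (simp add: C_def V_def)
    have "j mod 3 \<noteq> (j + 1) mod 3" by presburger
    then show "C i j \<noteq> C i (j + 1)"
      using same_index[of "(i, j mod 3)" "(i, (j + 1) mod 3)"] \<open>i < N\<close> by (auto simp: C_def V_def)
  qed (simp_all add: a_def C_def)
  thus ?thesis by (simp add: N_def numeral_2_eq_2)
qed

theorem mainTheorem17:
  fixes l n :: nat
  assumes "l \<ge> 1" and "n \<ge> 2"
  shows "beth 3 l n \<le> enat ((2 * l - 1) * (n - 1) * (n - 2))"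
  unfolding beth_def by (rule Sup_least) (auto dest: light_system_bound)

end
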